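(* For $n\geq 3$, the rank of $\mathsf{L}_{2}$ is $2n-4$.
   Context: For a positive integer $n$, let $X_n=\{1<2<\cdots<n\}$ and let $\mathcal{O}_n$ be the semigroup of all order-preserving maps $\alpha: X_n\to X_n$ (i.e. $x<y$ implies $x\alpha\leq y\alpha$) under composition. Maps are written on the right and composed left to right: $x(\alpha\beta)=(x\alpha)\beta$. For $1\leq k\leq n$, $\pi_k\in\mathcal{O}_n$ is the constant map $x\pi_k=k$ for all $x\in X_n$, and $$\mathsf{L}_{k} = \{ \alpha \in \mathcal{O}_{n} : \alpha \beta= \pi_{k} \text{ for some } \beta\in \mathcal{O}_{n}\setminus\{\pi_k\} \},$$ which is a subsemigroup of $\mathcal{O}_n$. (For $n\geq 3$ one has $\mathsf{L}_2=\cdots=\mathsf{L}_{n-1}=\{\alpha\in\mathcal{O}_n: 1\notin\mathrm{im}(\alpha)\text{ or }n\notin\mathrm{im}(\alpha)\}$, where $\mathrm{im}(\alpha)=\{x\alpha:x\in X_n\}$.) For a semigroup $S$, $\langle A\rangle$ denotes the smallest subsemigroup of $S$ containing the non-empty subset $A$, and $\mathrm{rank}(S)=\min\{\lvert A\rvert : S=\langle A\rangle\}$. *)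

theory Defs
  imports Main "HOL-Library.FuncSet"
begin

text \<open>
  Semigroups are given by a multiplication and a carrier set. A subsemigroup is
  non-empty by convention. For \<open>A \<subseteq> S\<close> with \<open>A \<noteq> {}\<close> and \<open>S\<close> closed under
  multiplication, \<open>generated m S A\<close> is the smallest subsemigroup of \<open>S\<close> containing \<open>A\<close>.
\<close>

definition subsemigroup :: "('a \<Rightarrow> 'a \<Rightarrow> 'a) \<Rightarrow> 'a set \<Rightarrow> 'a set \<Rightarrow> bool" where
  "subsemigroup m S T \<longleftrightarrow> T \<subseteq> S \<and> T \<noteq> {} \<and> (\<forall>a\<in>T. \<forall>b\<in>T. m a b \<in> T)"

definition generated :: "('a \<Rightarrow> 'a \<Rightarrow> 'a) \<Rightarrow> 'a set \<Rightarrow> 'a set \<Rightarrow> 'a set" where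
  "generated m S A = \<Inter>{T. subsemigroup m S T \<and> A \<subseteq> T}"

text \<open>
  Only finite generating sets are considered, as \<open>card\<close> is \<open>0\<close> on infinite sets. The
  definition is therefore meaningful for finitely generated \<open>S\<close> only, in particular
  for finite \<open>S\<close>.
\<close>

definition semigroup_rank :: "('a \<Rightarrow> 'a \<Rightarrow> 'a) \<Rightarrow> 'a set \<Rightarrow> nat" where
  "semigroup_rank m S =
     (LEAST r. \<exists>A. A \<subseteq> S \<and> A \<noteq> {} \<and> finite A \<and> card A = r \<and> S = generated m S A)"

text \<open>
  Self-maps of \<open>{1..n}\<close> are represented by their extensional representatives, so that
  equality of maps is equality in HOL.
\<close>

definition order_preserving_maps :: "nat \<Rightarrow> (nat \<Rightarrow> nat) set" where
  "order_preserving_maps n = {\<alpha> \<in> {1..n} \<rightarrow>\<^sub>E {1..n}. mono_on {1..n} \<alpha>}"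

text \<open>Maps are composed from left to right: the product first applies \<open>\<alpha>\<close>, then \<open>\<beta>\<close>.\<close>

definition map_mult :: "nat \<Rightarrow> (nat \<Rightarrow> nat) \<Rightarrow> (nat \<Rightarrow> nat) \<Rightarrow> nat \<Rightarrow> nat" where
  "map_mult n \<alpha> \<beta> = compose {1..n} \<beta> \<alpha>"

definition const_map :: "nat \<Rightarrow> nat \<Rightarrow> nat \<Rightarrow> nat" where
  "const_map n k = (\<lambda>x\<in>{1..n}. k)"

definition L_semigroup :: "nat \<Rightarrow> nat \<Rightarrow> (nat \<Rightarrow> nat) set" where
  "L_semigroup n k =
     {\<alpha> \<in> order_preserving_maps n.
        \<exists>\<beta> \<in> order_preserving_maps n - {const_map n k}. map_mult n \<alpha> \<beta> = const_map n k}"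

lemma map_mult_closed:
  assumes "\<alpha> \<in> order_preserving_maps n" "\<beta> \<in> order_preserving_maps n"
  shows "map_mult n \<alpha> \<beta> \<in> order_preserving_maps n"
proof -
  have r: "\<alpha> x \<in> {1..n}" "\<beta> x \<in> {1..n}" if "x \<in> {1..n}" for x
    using assms that by (auto simp: order_preserving_maps_def dest: PiE_mem)
  have "mono_on {1..n} \<alpha>" "mono_on {1..n} \<beta>"
    using assms by (auto simp: order_preserving_maps_def)
  then show ?thesis
    using r unfolding order_preserving_maps_def map_mult_def compose_def monotone_on_def
    by (auto simp del: atLeastAtMost_iff)
qed

lemma L_semigroup_subsemigroup:
  assumes "2 \<le> n" "1 \<le> k" "k \<le> n"
  shows "subsemigroup (map_mult n) (order_preserving_maps n) (L_semigroup n k)"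
  unfolding subsemigroup_def
proof (intro conjI ballI)
  show "L_semigroup n k \<subseteq> order_preserving_maps n"
    by (auto simp: L_semigroup_def)
next
  let ?id = "\<lambda>x\<in>{1..n}. x"
  have c: "const_map n k \<in> order_preserving_maps n"
    and i: "?id \<in> order_preserving_maps n"
    using assms by (auto simp: order_preserving_maps_def const_map_def monotone_on_def)
  have "?id 1 \<noteq> const_map n k 1 \<or> ?id 2 \<noteq> const_map n k 2"
    using assms by (auto simp: const_map_def)
  then have ne: "?id \<noteq> const_map n k" by metis
  have "map_mult n (const_map n k) ?id = const_map n k"
    using assms by (auto simp: map_mult_def const_map_def compose_def fun_eq_iff)
  with c i ne show "L_semigroup n k \<noteq> {}"
    unfolding L_semigroup_def by blast
next
  fix \<alpha> \<gamma> assume \<alpha>: "\<alpha> \<in> L_semigroup n k" and \<gamma>: "\<gamma> \<in> L_semigroup n k"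
  then obtain \<beta> where \<beta>: "\<beta> \<in> order_preserving_maps n - {const_map n k}"
      "map_mult n \<gamma> \<beta> = const_map n k"
    unfolding L_semigroup_def by blast
  have O: "\<alpha> \<in> order_preserving_maps n" "\<gamma> \<in> order_preserving_maps n"
    using \<alpha> \<gamma> by (auto simp: L_semigroup_def)
  have r: "\<alpha> x \<in> {1..n}" if "x \<in> {1..n}" for x
    using O that by (auto simp: order_preserving_maps_def dest: PiE_mem)
  have e: "\<beta> (\<gamma> y) = k" if "y \<in> {1..n}" for y
    using fun_cong[OF \<beta>(2), of y] that by (simp add: map_mult_def const_map_def compose_def)
  have "map_mult n (map_mult n \<alpha> \<gamma>) \<beta> = const_map n k"
    using r e by (auto simp: map_mult_def const_map_def compose_def fun_eq_iff simp del: atLeastAtMost_iff)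
  with \<beta>(1) map_mult_closed[OF O] show "map_mult n \<alpha> \<gamma> \<in> L_semigroup n k"
    unfolding L_semigroup_def by blast
qed

end

theory Submission
  imports Defs "HOL-Library.Disjoint_Sets"
begin

text \<open>
  Write \<open>S\<close> for the semigroup in question. It consists of the order-preserving maps that do
  not fix both \<open>1\<close> and \<open>n\<close> (lemma \<open>L_semigroup_2_iff\<close>); equivalently, the image of the map
  spans at most \<open>n - 1\<close> consecutive points.

  \<^bold>\<open>Lower bound.\<close> Call a set \<open>P\<close> prime if a product lies in \<open>P\<close> only when one of its factors does.
  The complement of a prime set is closed under products, so a generating set meets every
  prime set that contains an element of \<open>S\<close> (\<open>generating_set_meets_prime\<close>). There are \<open>2 n - 4\<close>
  pairwise disjoint prime sets.
  \<^item> For \<open>1 \<le> i \<le> n - 1\<close>, the maps that identify \<open>i\<close> and \<open>i + 1\<close> and nothing else. A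
    product inherits every identification made by its first factor, and every element of \<open>S\<close>
    makes at least one, so the first factor is again such a map.
  \<^item> For \<open>1 \<le> d \<le> n - 3\<close>, the maps whose image, translated to start at \<open>0\<close>, is
    \<open>{0..n - 2} - {d}\<close>. The image of the second factor \<open>\<delta>\<close> contains the image of the product
    and has no room for more than the missing point. If it omits this point, \<open>\<delta>\<close>
    is such a map. If it includes it, the image of \<open>\<delta>\<close> is an interval and \<open>\<delta>\<close> does not increase
    distances. But the image of the first factor has diameter at most \<open>n - 2\<close>, which is already
    the diameter of the image of the product, so \<open>\<delta>\<close> acts on it as a translation, and the
    first factor is such a map.

  \<^bold>\<open>Upper bound.\<close> The generators are the maps \<open>collapse n j\<close> onto \<open>{1..n - 1}\<close> for \<open>j \<le> n - 2\<close>,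
  one map \<open>shift_up n\<close> onto \<open>{2..n}\<close>, and the maps \<open>skip n m\<close> with image \<open>{1..n - 1} - {m}\<close> for
  \<open>2 \<le> m \<le> n - 2\<close>: together \<open>(n - 2) + 1 + (n - 3)\<close> maps. Elements of \<open>S\<close> whose image is an initial
  interval are products of collapses (\<open>collapses_generate_gapless\<close>). A gap in the image of a
  map into \<open>{1..n - 1}\<close> is created by a final factor \<open>skip n m\<close>, which
  permits induction on the largest value (\<open>generate_maps_below_n\<close>). The remaining maps avoid \<open>1\<close>
  and are obtained from these by a final \<open>shift_up n\<close>.
\<close>

section \<open>Order-preserving maps\<close>

lemma opm_range:
  assumes "\<alpha> \<in> order_preserving_maps n" "1 \<le> x" "x \<le> n"
  shows "1 \<le> \<alpha> x" "\<alpha> x \<le> n"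
proof -
  have "\<alpha> x \<in> {1..n}"
    using assms unfolding order_preserving_maps_def by (auto dest: PiE_mem)
  then show "1 \<le> \<alpha> x" "\<alpha> x \<le> n" by auto
qed

lemma opm_mono:
  assumes "\<alpha> \<in> order_preserving_maps n" "1 \<le> x" "x \<le> y" "y \<le> n"
  shows "\<alpha> x \<le> \<alpha> y"
  using assms unfolding order_preserving_maps_def by (auto intro: mono_onD)

lemma opm_eqI:
  assumes "\<alpha> \<in> order_preserving_maps n" "\<beta> \<in> order_preserving_maps n"
    and "\<And>x. 1 \<le> x \<Longrightarrow> x \<le> n \<Longrightarrow> \<alpha> x = \<beta> x"
  shows "\<alpha> = \<beta>"
  using assms unfolding order_preserving_maps_def by (auto intro: PiE_ext)

lemma restrict_opm:
  assumes "\<And>x. 1 \<le> x \<Longrightarrow> x \<le> n \<Longrightarrow> 1 \<le> f x \<and> f x \<le> n"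
    and "\<And>x y. 1 \<le> x \<Longrightarrow> x \<le> y \<Longrightarrow> y \<le> n \<Longrightarrow> f x \<le> f y"
  shows "restrict f {1..n} \<in> order_preserving_maps n"
  using assms unfolding order_preserving_maps_def by (auto simp: monotone_on_def)

lemma map_mult_apply:
  assumes "1 \<le> x" "x \<le> n"
  shows "map_mult n \<alpha> \<beta> x = \<beta> (\<alpha> x)"
  using assms by (simp add: map_mult_def compose_def)

lemma unit_steps_bound:
  fixes \<alpha> :: "nat \<Rightarrow> nat"
  assumes step: "\<And>x. 1 \<le> x \<Longrightarrow> x < n \<Longrightarrow> \<alpha> (Suc x) \<le> Suc (\<alpha> x)"
    and "x \<le> y" "1 \<le> x" "y \<le> n"
  shows "\<alpha> y \<le> \<alpha> x + (y - x)"
  using \<open>x \<le> y\<close> \<open>y \<le> n\<close>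
proof (induction y rule: dec_induct)
  case (step y)
  then show ?case using assms(1)[of y] \<open>1 \<le> x\<close> by auto
qed simp

lemma strict_steps_bound:
  fixes \<alpha> :: "nat \<Rightarrow> nat"
  assumes step: "\<And>x. 1 \<le> x \<Longrightarrow> x < n \<Longrightarrow> \<alpha> x < \<alpha> (Suc x)"
    and "x \<le> y" "1 \<le> x" "y \<le> n"
  shows "\<alpha> x + (y - x) \<le> \<alpha> y"
  using \<open>x \<le> y\<close> \<open>y \<le> n\<close>
proof (induction y rule: dec_induct)
  case (step y)
  then show ?case using assms(1)[of y] \<open>1 \<le> x\<close> by auto
qed simp

text \<open>
  A map without identifications climbs by at least \<open>1\<close> at each step, which leaves it no choice
  but to start at \<open>1\<close> and end at \<open>n\<close>.
\<close>

lemma merges_neighbours_unless_fixes_ends: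
  assumes n: "1 \<le> n" and O: "\<alpha> \<in> order_preserving_maps n" and ends: "\<not> (\<alpha> 1 = 1 \<and> \<alpha> n = n)"
  obtains x where "1 \<le> x" "x < n" "\<alpha> x = \<alpha> (Suc x)"
proof -
  have "\<exists>x. 1 \<le> x \<and> x < n \<and> \<alpha> x = \<alpha> (Suc x)"
  proof (rule ccontr)
    assume none: "\<nexists>x. 1 \<le> x \<and> x < n \<and> \<alpha> x = \<alpha> (Suc x)"
    have "\<alpha> x < \<alpha> (Suc x)" if x: "1 \<le> x" "x < n" for x
    proof -
      have "\<alpha> x \<noteq> \<alpha> (Suc x)" using none x by blast
      with opm_mono[OF O, of x "Suc x"] x show ?thesis by linarith
    qed
    then have "\<alpha> 1 + (n - 1) \<le> \<alpha> n" using strict_steps_bound[of n \<alpha> 1 n] n by auto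
    with ends opm_range[OF O, of 1] opm_range[OF O, of n] n show False by linarith
  qed
  with that show thesis by blast
qed

text \<open>
  A map that fixes both end points can be followed only by \<open>\<pi>\<^sub>2\<close> itself if the product is to be
  \<open>\<pi>\<^sub>2\<close>. Otherwise an end point is missing from the image, and the witness fixes that end
  point and sends all others to \<open>2\<close>; it differs from \<open>\<pi>\<^sub>2\<close> because \<open>2\<close> is an interior point.
\<close>

lemma L_semigroup_2_iff:
  assumes "3 \<le> n"
  shows "\<alpha> \<in> L_semigroup n 2 \<longleftrightarrow> \<alpha> \<in> order_preserving_maps n \<and> \<not> (\<alpha> 1 = 1 \<and> \<alpha> n = n)"
proof (intro iffI conjI)
  assume L: "\<alpha> \<in> L_semigroup n 2"
  then show O: "\<alpha> \<in> order_preserving_maps n" by (simp add: L_semigroup_def)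
  obtain \<beta> where \<beta>: "\<beta> \<in> order_preserving_maps n" "\<beta> \<noteq> const_map n 2"
      "map_mult n \<alpha> \<beta> = const_map n 2"
    using L unfolding L_semigroup_def by blast
  show "\<not> (\<alpha> 1 = 1 \<and> \<alpha> n = n)"
  proof
    assume fix_ends: "\<alpha> 1 = 1 \<and> \<alpha> n = n"
    have "\<beta> (\<alpha> x) = 2" if "1 \<le> x" "x \<le> n" for x
      using fun_cong[OF \<beta>(3), of x] that by (simp add: map_mult_apply const_map_def)
    from this[of 1] this[of n] have ends: "\<beta> 1 = 2" "\<beta> n = 2" using fix_ends assms by simp_all
    have "\<beta> x = 2" if "1 \<le> x" "x \<le> n" for x
      using opm_mono[OF \<beta>(1), of 1 x] opm_mono[OF \<beta>(1), of x n] ends that by auto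
    moreover have "const_map n 2 \<in> order_preserving_maps n"
      unfolding const_map_def using assms by (intro restrict_opm) auto
    ultimately have "\<beta> = const_map n 2"
      using \<beta>(1) by (intro opm_eqI) (auto simp: const_map_def)
    with \<beta>(2) show False by simp
  qed
next
  assume R: "\<alpha> \<in> order_preserving_maps n \<and> \<not> (\<alpha> 1 = 1 \<and> \<alpha> n = n)"
  then have O: "\<alpha> \<in> order_preserving_maps n" by simp
  have c: "const_map n 2 \<in> order_preserving_maps n"
    unfolding const_map_def using assms by (intro restrict_opm) auto
  define e where "e = (if \<alpha> 1 = 1 then n else 1)"
  define \<beta> where "\<beta> = (\<lambda>x\<in>{1..n}. if x = e then e else 2)"
  have \<beta>: "\<beta> \<in> order_preserving_maps n"
    unfolding \<beta>_def e_def using assms by (intro restrict_opm) auto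
  have e: "1 \<le> e" "e \<le> n" "e \<noteq> 2" using assms by (auto simp: e_def)
  have "\<beta> e \<noteq> const_map n 2 e" using e by (simp add: \<beta>_def const_map_def)
  then have ne: "\<beta> \<noteq> const_map n 2" by auto
  have "\<alpha> x \<noteq> e" if "1 \<le> x" "x \<le> n" for x
    using opm_mono[OF O, of 1 x] opm_mono[OF O, of x n] opm_range[OF O, of 1]
      opm_range[OF O, of n] that R assms by (auto simp: e_def split: if_splits)
  then have "map_mult n \<alpha> \<beta> = const_map n 2"
    using opm_range[OF O]
    by (intro opm_eqI[OF map_mult_closed[OF O \<beta>] c])
       (auto simp: map_mult_apply const_map_def \<beta>_def)
  with O \<beta> ne show "\<alpha> \<in> L_semigroup n 2" unfolding L_semigroup_def by blast
qed

section \<open>Lower bound: disjoint prime classes\<close>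

lemma generating_set_meets_prime:
  assumes S: "S = generated m S A" and closed: "\<And>a b. a \<in> S \<Longrightarrow> b \<in> S \<Longrightarrow> m a b \<in> S"
    and A: "A \<subseteq> S" "A \<noteq> {}" and P: "S \<inter> P \<noteq> {}"
    and prime: "\<And>a b. a \<in> S \<Longrightarrow> b \<in> S \<Longrightarrow> m a b \<in> P \<Longrightarrow> a \<in> P \<or> b \<in> P"
  shows "A \<inter> P \<noteq> {}"
proof
  assume "A \<inter> P = {}"
  then have "A \<subseteq> S - P" using A by auto
  moreover from this have "subsemigroup m S (S - P)"
    unfolding subsemigroup_def using A closed prime by blast
  ultimately have "generated m S A \<subseteq> S - P" unfolding generated_def by blast
  with S P show False by blast
qed

lemma card_le_if_meets_disjoint_family:
  assumes "finite A" "disjoint_family_on K I" "\<And>i. i \<in> I \<Longrightarrow> A \<inter> K i \<noteq> {}"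
  shows "card I \<le> card A"
proof -
  have "\<forall>i\<in>I. \<exists>a. a \<in> A \<inter> K i" using assms(3) by blast
  then obtain f where f: "\<And>i. i \<in> I \<Longrightarrow> f i \<in> A \<inter> K i" by metis
  have "inj_on f I"
    using f assms(2) unfolding inj_on_def disjoint_family_on_def by (metis Int_iff empty_iff)
  then show ?thesis using f assms(1) by (intro card_inj_on_le[of f I A]) auto
qed

definition single_merge :: "nat \<Rightarrow> nat \<Rightarrow> (nat \<Rightarrow> nat) set" where
  "single_merge n i = {\<alpha>. \<forall>x\<in>{1..<n}. \<alpha> x = \<alpha> (Suc x) \<longleftrightarrow> x = i}"

text \<open>
  For an order-preserving \<open>\<alpha>\<close> the subtraction is never truncated, as \<open>\<alpha> 1\<close> is the least value.
\<close>

definition image_shape :: "nat \<Rightarrow> (nat \<Rightarrow> nat) \<Rightarrow> nat set" where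
  "image_shape n \<alpha> = (\<lambda>x. \<alpha> x - \<alpha> 1) ` {1..n}"

definition one_gap :: "nat \<Rightarrow> nat \<Rightarrow> (nat \<Rightarrow> nat) set" where
  "one_gap n d = {\<alpha>. image_shape n \<alpha> = {0..n - 2} - {d}}"

lemma single_merge_prime:
  assumes n: "3 \<le> n" and \<gamma>: "\<gamma> \<in> L_semigroup n 2"
    and prod: "map_mult n \<gamma> \<delta> \<in> single_merge n i"
  shows "\<gamma> \<in> single_merge n i"
proof -
  have O: "\<gamma> \<in> order_preserving_maps n" and ends: "\<not> (\<gamma> 1 = 1 \<and> \<gamma> n = n)"
    using \<gamma> n by (auto simp: L_semigroup_2_iff)
  have only: "x = i" if "1 \<le> x" "x < n" "\<gamma> x = \<gamma> (Suc x)" for x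
    using prod that by (auto simp: single_merge_def map_mult_apply)
  obtain x where x: "1 \<le> x" "x < n" "\<gamma> x = \<gamma> (Suc x)"
    using merges_neighbours_unless_fixes_ends[OF _ O ends] n by auto
  moreover from this have "x = i" using only by blast
  ultimately have "\<gamma> i = \<gamma> (Suc i)" by simp
  with only show ?thesis unfolding single_merge_def by auto
qed

lemma L_semigroup_2_span:
  assumes n: "3 \<le> n" and \<alpha>: "\<alpha> \<in> L_semigroup n 2"
  shows "\<alpha> n \<le> \<alpha> 1 + (n - 2)"
proof -
  have "\<alpha> \<in> order_preserving_maps n" and "\<not> (\<alpha> 1 = 1 \<and> \<alpha> n = n)"
    using \<alpha> n by (auto simp: L_semigroup_2_iff)
  with opm_range[of \<alpha> n 1] opm_range[of \<alpha> n n] n show ?thesis by linarith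
qed

text \<open>A jump by two or more would leave a value of the interval unattained.\<close>

lemma interval_image_unit_steps:
  assumes O: "\<delta> \<in> order_preserving_maps n" and shape: "image_shape n \<delta> = {0..k}"
    and x: "1 \<le> x" "x < n"
  shows "\<delta> (Suc x) \<le> Suc (\<delta> x)"
proof (rule ccontr)
  assume jump: "\<not> \<delta> (Suc x) \<le> Suc (\<delta> x)"
  have "\<delta> (Suc x) - \<delta> 1 \<in> image_shape n \<delta>" using x by (auto simp: image_shape_def)
  then have "\<delta> (Suc x) - \<delta> 1 \<le> k" using shape by auto
  then have "Suc (\<delta> x) - \<delta> 1 \<in> image_shape n \<delta>" using jump shape by auto
  then obtain z where z: "1 \<le> z" "z \<le> n" "\<delta> z - \<delta> 1 = Suc (\<delta> x) - \<delta> 1"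
    by (auto simp: image_shape_def)
  then have "\<delta> z = Suc (\<delta> x)"
    using opm_mono[OF O, of 1 z] opm_mono[OF O, of 1 x] x by linarith
  moreover have "\<delta> z \<le> \<delta> x \<or> \<delta> (Suc x) \<le> \<delta> z"
    using opm_mono[OF O, of z x] opm_mono[OF O, of "Suc x" z] z x by linarith
  ultimately show False using jump by linarith
qed

lemma one_gap_prime:
  assumes n: "3 \<le> n" and d: "1 \<le> d" "d \<le> n - 3"
    and \<gamma>: "\<gamma> \<in> L_semigroup n 2" and \<delta>: "\<delta> \<in> L_semigroup n 2"
    and prod: "map_mult n \<gamma> \<delta> \<in> one_gap n d"
  shows "\<gamma> \<in> one_gap n d \<or> \<delta> \<in> one_gap n d"
proof -
  let ?p = "map_mult n \<gamma> \<delta>"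
  have O: "\<gamma> \<in> order_preserving_maps n" "\<delta> \<in> order_preserving_maps n"
    using \<gamma> \<delta> n by (auto simp: L_semigroup_2_iff)
  note Op = map_mult_closed[OF O]
  have p: "?p x = \<delta> (\<gamma> x)" if "1 \<le> x" "x \<le> n" for x using that by (simp add: map_mult_apply)
  have shape_p: "image_shape n ?p = {0..n - 2} - {d}" using prod by (simp add: one_gap_def)
  have "n - 2 \<in> image_shape n ?p" using shape_p d n by auto
  then obtain w where w: "1 \<le> w" "w \<le> n" "n - 2 = ?p w - ?p 1"
    by (auto simp: image_shape_def)
  have span_p: "?p 1 + (n - 2) \<le> ?p n"
    using w opm_mono[OF Op, of w n] opm_mono[OF Op, of 1 w] by linarith
  have \<gamma>r: "1 \<le> \<gamma> x" "\<gamma> x \<le> n" if "1 \<le> x" "x \<le> n" for x using opm_range[OF O(1)] that by auto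
  \<comment> \<open>The image of \<open>\<delta>\<close> contains that of the product and has no larger span, so both start
    at the same point and their shapes can be compared.\<close>
  have "\<delta> 1 \<le> \<delta> (\<gamma> 1)" "\<delta> (\<gamma> n) \<le> \<delta> n"
    using \<gamma>r[of 1] \<gamma>r[of n] n by (auto intro!: opm_mono[OF O(2)])
  then have start: "?p 1 = \<delta> 1"
    using span_p L_semigroup_2_span[OF n \<delta>] p[of 1] p[of n] n by simp
  have sub: "image_shape n ?p \<subseteq> image_shape n \<delta>"
  proof
    fix v assume "v \<in> image_shape n ?p"
    then obtain x where "1 \<le> x" "x \<le> n" "v = ?p x - ?p 1" by (auto simp: image_shape_def)
    then show "v \<in> image_shape n \<delta>"
      using \<gamma>r[of x] start p[of x] unfolding image_shape_def
      by (intro image_eqI[of _ _ "\<gamma> x"]) auto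
  qed
  have sup: "image_shape n \<delta> \<subseteq> {0..n - 2}"
  proof
    fix v assume "v \<in> image_shape n \<delta>"
    then obtain x where "1 \<le> x" "x \<le> n" "v = \<delta> x - \<delta> 1" by (auto simp: image_shape_def)
    then show "v \<in> {0..n - 2}"
      using L_semigroup_2_span[OF n \<delta>] opm_mono[OF O(2), of x n] by auto
  qed
  show ?thesis
  proof (cases "d \<in> image_shape n \<delta>")
    case False
    then have "image_shape n \<delta> = {0..n - 2} - {d}" using sub sup shape_p by auto
    then show ?thesis by (simp add: one_gap_def)
  next
    case True
    then have "image_shape n \<delta> = {0..n - 2}" using sub sup shape_p by auto
    note steps = interval_image_unit_steps[OF O(2) this]
    \<comment> \<open>The two distances \<open>\<gamma> x - \<gamma> 1\<close> and \<open>\<gamma> n - \<gamma> x\<close> cannot grow under \<open>\<delta>\<close>, and their sum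
      cannot shrink; so neither changes.\<close>
    have "?p x - ?p 1 = \<gamma> x - \<gamma> 1" if x: "1 \<le> x" "x \<le> n" for x
    proof -
      have m: "\<gamma> 1 \<le> \<gamma> x" "\<gamma> x \<le> \<gamma> n" using x by (auto intro!: opm_mono[OF O(1)])
      have "\<delta> (\<gamma> x) \<le> \<delta> (\<gamma> 1) + (\<gamma> x - \<gamma> 1)"
        using m \<gamma>r[of 1] \<gamma>r[of x] x n by (intro unit_steps_bound[of n \<delta>, OF steps]) auto
      moreover have "\<delta> (\<gamma> n) \<le> \<delta> (\<gamma> x) + (\<gamma> n - \<gamma> x)"
        using m \<gamma>r[of n] \<gamma>r[of x] x n by (intro unit_steps_bound[of n \<delta>, OF steps]) auto
      ultimately show ?thesis
        using span_p L_semigroup_2_span[OF n \<gamma>] m p[of 1] p[of n] p[of x] x n by simp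
    qed
    then have "image_shape n ?p = image_shape n \<gamma>"
      unfolding image_shape_def by (intro image_cong) auto
    with prod show ?thesis by (simp add: one_gap_def)
  qed
qed

text \<open>
  Maps of the first kind have \<open>n - 1\<close> values, those of the second kind only \<open>n - 2\<close>.
\<close>

lemma single_merge_one_gap_disjoint:
  assumes n: "3 \<le> n" and i: "1 \<le> i" "i < n" and d: "1 \<le> d" "d \<le> n - 3"
    and O: "\<alpha> \<in> order_preserving_maps n" and \<alpha>: "\<alpha> \<in> single_merge n i"
  shows "\<alpha> \<notin> one_gap n d"
proof
  assume gap: "\<alpha> \<in> one_gap n d"
  have less: "\<alpha> x < \<alpha> y" if "1 \<le> x" "x < y" "y \<le> n" "x \<noteq> i" for x y
  proof -
    have "\<alpha> x \<noteq> \<alpha> (Suc x)" using \<alpha> that by (auto simp: single_merge_def)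
    with opm_mono[OF O, of x "Suc x"] opm_mono[OF O, of "Suc x" y] that show ?thesis by linarith
  qed
  have "inj_on (\<lambda>x. \<alpha> x - \<alpha> 1) ({1..n} - {i})"
  proof (rule linorder_inj_onI')
    fix x y assume "x \<in> {1..n} - {i}" "y \<in> {1..n} - {i}" "x < y"
    then show "\<alpha> x - \<alpha> 1 \<noteq> \<alpha> y - \<alpha> 1"
      using less[of x y] opm_mono[OF O, of 1 x] by auto
  qed
  moreover have "(\<lambda>x. \<alpha> x - \<alpha> 1) ` ({1..n} - {i}) \<subseteq> {0..n - 2} - {d}"
    using gap unfolding one_gap_def image_shape_def by auto
  ultimately have "card ({1..n} - {i}) \<le> card ({0..n - 2} - {d})"
    by (intro card_inj_on_le) auto
  then show False using i d n by simp
qed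

section \<open>The generators\<close>

definition collapse :: "nat \<Rightarrow> nat \<Rightarrow> nat \<Rightarrow> nat" where
  "collapse n j = (\<lambda>x\<in>{1..n}. if x \<le> j then x else x - 1)"

definition shift_up :: "nat \<Rightarrow> nat \<Rightarrow> nat" where
  "shift_up n = (\<lambda>x\<in>{1..n}. min (Suc x) n)"

definition skip :: "nat \<Rightarrow> nat \<Rightarrow> nat \<Rightarrow> nat" where
  "skip n m = (\<lambda>x\<in>{1..n}. if x < m then x else min (Suc x) (n - 1))"

lemma collapse_in_L:
  assumes "3 \<le> n" "1 \<le> j" "j < n"
  shows "collapse n j \<in> L_semigroup n 2"
proof -
  have "collapse n j \<in> order_preserving_maps n"
    unfolding collapse_def using assms by (intro restrict_opm) auto
  then show ?thesis using assms by (simp add: L_semigroup_2_iff collapse_def)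
qed

lemma shift_up_in_L:
  assumes "3 \<le> n"
  shows "shift_up n \<in> L_semigroup n 2"
proof -
  have "shift_up n \<in> order_preserving_maps n"
    unfolding shift_up_def using assms by (intro restrict_opm) auto
  then show ?thesis using assms by (simp add: L_semigroup_2_iff shift_up_def)
qed

lemma skip_in_L:
  assumes "3 \<le> n" "1 \<le> m" "m \<le> n - 2"
  shows "skip n m \<in> L_semigroup n 2"
proof -
  have "skip n m \<in> order_preserving_maps n"
    unfolding skip_def using assms by (intro restrict_opm) auto
  then show ?thesis using assms by (auto simp: L_semigroup_2_iff skip_def)
qed

lemma collapse_single_merge:
  assumes "1 \<le> j" "j < n"
  shows "collapse n j \<in> single_merge n j"
  using assms by (auto simp: single_merge_def collapse_def)

lemma skip_one_gap:
  assumes "3 \<le> n" "1 \<le> d" "d \<le> n - 3"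
  shows "skip n (Suc d) \<in> one_gap n d"
proof -
  have start: "skip n (Suc d) 1 = 1" using assms by (simp add: skip_def)
  have "{0..n - 2} - {d} \<subseteq> image_shape n (skip n (Suc d))"
  proof
    fix v assume v: "v \<in> {0..n - 2} - {d}"
    define x where "x = (if v < d then Suc v else v)"
    have "x \<in> {1..n}" "v = skip n (Suc d) x - skip n (Suc d) 1"
      using v assms start by (auto simp: x_def skip_def)
    then show "v \<in> image_shape n (skip n (Suc d))" unfolding image_shape_def by blast
  qed
  moreover have "image_shape n (skip n (Suc d)) \<subseteq> {0..n - 2} - {d}"
    using assms start by (auto simp: image_shape_def skip_def min_def split: if_splits)
  ultimately show ?thesis by (simp add: one_gap_def)
qed

lemma generating_set_card_ge:
  assumes n: "3 \<le> n" and A: "A \<subseteq> L_semigroup n 2" "A \<noteq> {}" "finite A"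
    and gen: "L_semigroup n 2 = generated (map_mult n) (L_semigroup n 2) A"
  shows "2 * n - 4 \<le> card A"
proof -
  let ?S = "L_semigroup n 2"
  let ?I = "{1..<n} <+> {1..n - 3}"
  let ?K = "\<lambda>c. ?S \<inter> case_sum (single_merge n) (one_gap n) c"
  have closed: "map_mult n a b \<in> ?S" if "a \<in> ?S" "b \<in> ?S" for a b
    using L_semigroup_subsemigroup[of n 2] n that by (auto simp: subsemigroup_def)
  have SO: "?S \<subseteq> order_preserving_maps n" by (auto simp: L_semigroup_def)
  have "A \<inter> ?K c \<noteq> {}" if c: "c \<in> ?I" for c
  proof (rule generating_set_meets_prime[OF gen closed A(1,2)])
    show "?S \<inter> ?K c \<noteq> {}"
      using c
    proof (elim PlusE)
      fix i assume "i \<in> {1..<n}" "c = Inl i"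
      then show ?thesis using collapse_in_L[OF n, of i] collapse_single_merge[of i n] by auto
    next
      fix d assume "d \<in> {1..n - 3}" "c = Inr d"
      moreover from this have "Suc d \<le> n - 2" using n by auto
      ultimately show ?thesis using skip_in_L[OF n, of "Suc d"] skip_one_gap[OF n, of d] by auto
    qed
    fix a b assume "a \<in> ?S" "b \<in> ?S" "map_mult n a b \<in> ?K c"
    then show "a \<in> ?K c \<or> b \<in> ?K c"
      using c single_merge_prime[OF n] one_gap_prime[OF n] by fastforce
  qed
  moreover have "disjoint_family_on ?K ?I"
  proof -
    have SS: "single_merge n i \<inter> single_merge n j = {}" if "i \<in> {1..<n}" "i \<noteq> j" for i j
      using that by (auto simp: single_merge_def)
    have GG: "one_gap n d \<inter> one_gap n e = {}" if "d \<in> {1..n - 3}" "d \<noteq> e" for d e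
    proof -
      have "d \<in> {0..n - 2} - {e}" "d \<notin> {0..n - 2} - {d}" using that by auto
      then have "{0..n - 2} - {d} \<noteq> {0..n - 2} - {e}" by metis
      then show ?thesis by (auto simp: one_gap_def)
    qed
    have SG: "?S \<inter> single_merge n i \<inter> one_gap n d = {}"
      if "i \<in> {1..<n}" "d \<in> {1..n - 3}" for i d
      using single_merge_one_gap_disjoint[OF n, of i d] SO that by auto
    show ?thesis
      unfolding disjoint_family_on_def
    proof (intro ballI impI)
      fix c e assume "c \<in> ?I" "e \<in> ?I" "c \<noteq> e"
      then show "?K c \<inter> ?K e = {}"
        using SS GG SG by (elim PlusE) (simp_all, blast+)
    qed
  qed
  ultimately have "card ?I \<le> card A" using A(3) by (intro card_le_if_meets_disjoint_family) auto
  moreover have "card ?I = 2 * n - 4" using n by (simp add: card_Plus)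
  ultimately show ?thesis by simp
qed

section \<open>Upper bound: factorizations\<close>

text \<open>
  If the image is \<open>{1..r}\<close> with \<open>r < n\<close>, some \<open>x\<close> and \<open>x + 1\<close> have the same image \<open>j\<close>.
  Separating them, by raising all values after \<open>x\<close>, gives a map onto \<open>{1..r + 1}\<close>, and \<open>collapse n j\<close>
  undoes this. Iteration ends at the identity, which does not belong to the semigroup; hence
  the disjunction.
\<close>

lemma collapses_generate_gapless:
  assumes n: "1 \<le> n"
    and closed: "\<And>a b. a \<in> T \<Longrightarrow> b \<in> T \<Longrightarrow> map_mult n a b \<in> T"
    and coll: "\<And>j. 1 \<le> j \<Longrightarrow> j < n \<Longrightarrow> collapse n j \<in> T"
    and \<alpha>: "\<alpha> \<in> order_preserving_maps n" "\<alpha> 1 = 1"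
      "\<And>x. 1 \<le> x \<Longrightarrow> x < n \<Longrightarrow> \<alpha> (Suc x) \<le> Suc (\<alpha> x)"
  shows "\<alpha> = (\<lambda>x\<in>{1..n}. x) \<or> \<alpha> \<in> T"
  using \<alpha>
proof (induction "n - \<alpha> n" arbitrary: \<alpha> rule: less_induct)
  case less
  note O = less.prems(1) and start = less.prems(2) and steps = less.prems(3)
  let ?id = "\<lambda>x\<in>{1..n}. x"
  have idO: "?id \<in> order_preserving_maps n" by (intro restrict_opm) auto
  show ?case
  proof (cases "\<alpha> n = n")
    case True
    have "\<alpha> x = x" if x: "1 \<le> x" "x \<le> n" for x
      using unit_steps_bound[of n \<alpha>, OF steps, of 1 x] unit_steps_bound[of n \<alpha>, OF steps, of x n]
        start True x by simp
    then have "\<alpha> = ?id" using O idO by (intro opm_eqI) auto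
    then show ?thesis by simp
  next
    case False
    then have "\<not> (\<alpha> 1 = 1 \<and> \<alpha> n = n)" by simp
    then obtain x where x: "1 \<le> x" "x < n" "\<alpha> x = \<alpha> (Suc x)"
      using n O by (blast elim: merges_neighbours_unless_fixes_ends)
    have top: "\<alpha> n < n" using False opm_range[OF O, of n] n by auto
    have below: "\<alpha> y \<le> \<alpha> n" if "1 \<le> y" "y \<le> n" for y using opm_mono[OF O, of y n] that by auto
    define \<beta> where "\<beta> = (\<lambda>y\<in>{1..n}. if y \<le> x then \<alpha> y else Suc (\<alpha> y))"
    have \<beta>: "\<beta> y = (if y \<le> x then \<alpha> y else Suc (\<alpha> y))" if "1 \<le> y" "y \<le> n" for y
      using that by (simp add: \<beta>_def)
    have \<beta>O: "\<beta> \<in> order_preserving_maps n"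
      unfolding \<beta>_def
    proof (intro restrict_opm)
      fix y assume "1 \<le> y" "y \<le> n"
      then show "1 \<le> (if y \<le> x then \<alpha> y else Suc (\<alpha> y)) \<and> (if y \<le> x then \<alpha> y else Suc (\<alpha> y)) \<le> n"
        using below[of y] top opm_range[OF O, of y] by auto
    next
      fix y z assume "1 \<le> y" "y \<le> z" "z \<le> n"
      then show "(if y \<le> x then \<alpha> y else Suc (\<alpha> y)) \<le> (if z \<le> x then \<alpha> z else Suc (\<alpha> z))"
        using opm_mono[OF O, of y z] by auto
    qed
    have \<beta>n: "\<beta> n = Suc (\<alpha> n)" using \<beta>[of n] x by auto
    have \<beta>T: "\<beta> = ?id \<or> \<beta> \<in> T"
    proof (rule less.hyps[OF _ \<beta>O])
      show "n - \<beta> n < n - \<alpha> n" using \<beta>n top by simp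
      show "\<beta> 1 = 1" using \<beta>[of 1] start x by simp
      fix y assume y: "1 \<le> y" "y < n"
      show "\<beta> (Suc y) \<le> Suc (\<beta> y)"
      proof (cases "y = x")
        case True
        then show ?thesis using \<beta>[of y] \<beta>[of "Suc y"] x by simp
      next
        case False
        then show ?thesis using \<beta>[of y] \<beta>[of "Suc y"] steps[OF y] y by auto
      qed
    qed
    have j: "1 \<le> \<alpha> x" "\<alpha> x < n" using opm_range[OF O, of x] below[of x] top x by auto
    have cO: "collapse n (\<alpha> x) \<in> order_preserving_maps n"
      unfolding collapse_def using j by (intro restrict_opm) auto
    have "map_mult n \<beta> (collapse n (\<alpha> x)) = \<alpha>"
    proof (rule opm_eqI[OF map_mult_closed[OF \<beta>O cO] O])
      fix y assume y: "1 \<le> y" "y \<le> n"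
      have "\<alpha> y \<le> \<alpha> x" if "y \<le> x" using opm_mono[OF O, of y x] that y x by simp
      moreover have "\<alpha> x \<le> \<alpha> y" if "\<not> y \<le> x" using opm_mono[OF O, of x y] that y x by simp
      ultimately show "map_mult n \<beta> (collapse n (\<alpha> x)) y = \<alpha> y"
        using y \<beta>[of y] opm_range[OF \<beta>O y] by (auto simp: map_mult_apply collapse_def)
    qed
    moreover have "map_mult n ?id (collapse n (\<alpha> x)) = collapse n (\<alpha> x)"
      using j by (intro opm_eqI[OF map_mult_closed[OF idO cO] cO]) (auto simp: map_mult_apply)
    ultimately show ?thesis using \<beta>T closed[OF _ coll[OF j]] coll[OF j] by metis
  qed
qed

text \<open>
  Let \<open>m\<close> be a point below the maximum of the image that is not attained. Lowering all values
  beyond \<open>m\<close> by one is undone by \<open>skip n m\<close>, and it lowers the largest value.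
\<close>

lemma generate_maps_below_n:
  assumes n: "3 \<le> n"
    and closed: "\<And>a b. a \<in> T \<Longrightarrow> b \<in> T \<Longrightarrow> map_mult n a b \<in> T"
    and coll: "\<And>j. 1 \<le> j \<Longrightarrow> j < n \<Longrightarrow> collapse n j \<in> T"
    and skip: "\<And>m. 1 \<le> m \<Longrightarrow> m \<le> n - 2 \<Longrightarrow> skip n m \<in> T"
    and \<alpha>: "\<alpha> \<in> order_preserving_maps n" "\<alpha> n < n"
  shows "\<alpha> \<in> T"
  using \<alpha>
proof (induction "\<alpha> n" arbitrary: \<alpha> rule: less_induct)
  case less
  note O = less.prems(1) and top = less.prems(2)
  have below: "\<alpha> y \<le> \<alpha> n" if "1 \<le> y" "y \<le> n" for y using opm_mono[OF O, of y n] that by auto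
  show ?case
  proof (cases "\<alpha> 1 = 1 \<and> (\<forall>x. 1 \<le> x \<longrightarrow> x < n \<longrightarrow> \<alpha> (Suc x) \<le> Suc (\<alpha> x))")
    case True
    then have "\<alpha> = (\<lambda>x\<in>{1..n}. x) \<or> \<alpha> \<in> T"
      using n by (intro collapses_generate_gapless[OF _ closed coll O]) auto
    moreover have "\<alpha> \<noteq> (\<lambda>x\<in>{1..n}. x)" using top n by auto
    ultimately show ?thesis by simp
  next
    case False
    have "\<exists>m. 1 \<le> m \<and> m < \<alpha> n \<and> (\<forall>y. 1 \<le> y \<longrightarrow> y \<le> n \<longrightarrow> \<alpha> y \<noteq> m)"
    proof (cases "\<alpha> 1 = 1")
      case False
      then have "\<alpha> y \<noteq> 1" if "1 \<le> y" "y \<le> n" for y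
        using opm_mono[OF O, of 1 y] opm_range[OF O, of 1] that by auto
      moreover have "1 < \<alpha> n" using False below[of 1] opm_range[OF O, of 1] n by auto
      ultimately show ?thesis by (intro exI[of _ 1]) auto
    next
      case True
      then obtain x where x: "1 \<le> x" "x < n" "Suc (\<alpha> x) < \<alpha> (Suc x)"
        using False by (auto simp: not_le)
      have "\<alpha> y \<noteq> Suc (\<alpha> x)" if "1 \<le> y" "y \<le> n" for y
        using opm_mono[OF O, of y x] opm_mono[OF O, of "Suc x" y] that x by (cases "y \<le> x") auto
      then show ?thesis using x below[of "Suc x"] by (intro exI[of _ "Suc (\<alpha> x)"]) auto
    qed
    then obtain m where m: "1 \<le> m" "m < \<alpha> n"
      and gap: "\<And>y. 1 \<le> y \<Longrightarrow> y \<le> n \<Longrightarrow> \<alpha> y \<noteq> m" by blast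
    define \<beta> where "\<beta> = (\<lambda>y\<in>{1..n}. if \<alpha> y < m then \<alpha> y else \<alpha> y - 1)"
    have \<beta>: "\<beta> y = (if \<alpha> y < m then \<alpha> y else \<alpha> y - 1)" if "1 \<le> y" "y \<le> n" for y
      using that by (simp add: \<beta>_def)
    have \<beta>O: "\<beta> \<in> order_preserving_maps n"
      unfolding \<beta>_def
    proof (intro restrict_opm)
      fix y assume y: "1 \<le> y" "y \<le> n"
      then show "1 \<le> (if \<alpha> y < m then \<alpha> y else \<alpha> y - 1) \<and> (if \<alpha> y < m then \<alpha> y else \<alpha> y - 1) \<le> n"
        using opm_range[OF O y] gap[OF y] m by auto
    next
      fix y z assume "1 \<le> y" "y \<le> z" "z \<le> n"
      then show "(if \<alpha> y < m then \<alpha> y else \<alpha> y - 1) \<le> (if \<alpha> z < m then \<alpha> z else \<alpha> z - 1)"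
        using opm_mono[OF O, of y z] gap[of y] gap[of z] by auto
    qed
    have \<beta>n: "\<beta> n = \<alpha> n - 1" using \<beta>[of n] m n by auto
    have \<beta>T: "\<beta> \<in> T"
      using \<beta>n m top by (intro less.hyps[OF _ \<beta>O]) auto
    have m2: "m \<le> n - 2" using m top by simp
    have sO: "skip n m \<in> order_preserving_maps n"
      using skip_in_L[OF n m(1) m2] by (simp add: L_semigroup_def)
    have "map_mult n \<beta> (skip n m) = \<alpha>"
    proof (rule opm_eqI[OF map_mult_closed[OF \<beta>O sO] O])
      fix y assume y: "1 \<le> y" "y \<le> n"
      show "map_mult n \<beta> (skip n m) y = \<alpha> y"
        using y \<beta>[OF y] opm_range[OF \<beta>O y] opm_range[OF O y] gap[OF y] below[OF y] top m
        by (auto simp: map_mult_apply skip_def)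
    qed
    then show ?thesis using closed[OF \<beta>T skip[OF m(1) m2]] by simp
  qed
qed

definition small_generators :: "nat \<Rightarrow> (nat \<Rightarrow> nat) set" where
  "small_generators n = insert (shift_up n) (collapse n ` {1..n - 2} \<union> skip n ` {2..n - 2})"

lemma card_small_generators_le:
  assumes "3 \<le> n"
  shows "card (small_generators n) \<le> 2 * n - 4"
proof -
  have "card (small_generators n)
      \<le> Suc (card (collapse n ` {1..n - 2} \<union> skip n ` {2..n - 2}))"
    unfolding small_generators_def by (rule card_insert_le_m1) auto
  also have "\<dots> \<le> Suc (card (collapse n ` {1..n - 2}) + card (skip n ` {2..n - 2}))"
    using card_Un_le by auto
  also have "\<dots> \<le> Suc (card {1..n - 2} + card {2..n - 2})"
    by (intro Suc_le_mono[THEN iffD2] add_mono card_image_le) auto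
  also have "\<dots> = 2 * n - 4" using assms by simp
  finally show ?thesis .
qed

text \<open>
  On \<open>{2..n}\<close> the map \<open>collapse n 1\<close> is the inverse of \<open>shift_up n\<close>. Moving the image up and down
  with these two supplies \<open>collapse n (n - 1)\<close> and \<open>skip n 1\<close>, the two factors occurring in
  \<open>generate_maps_below_n\<close> that are not among the generators.
\<close>

lemma small_generators_generate:
  assumes n: "3 \<le> n"
    and closed: "\<And>a b. a \<in> T \<Longrightarrow> b \<in> T \<Longrightarrow> map_mult n a b \<in> T"
    and gens: "small_generators n \<subseteq> T"
  shows "L_semigroup n 2 \<subseteq> T"
proof
  let ?u = "shift_up n"
  have LO: "a \<in> order_preserving_maps n" if "a \<in> L_semigroup n 2" for a
    using that by (simp add: L_semigroup_def)
  have up: "?u \<in> T" and c: "\<And>j. 1 \<le> j \<Longrightarrow> j \<le> n - 2 \<Longrightarrow> collapse n j \<in> T"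
    and s: "\<And>m. 2 \<le> m \<Longrightarrow> m \<le> n - 2 \<Longrightarrow> skip n m \<in> T"
    using gens by (auto simp: small_generators_def)
  note uO = LO[OF shift_up_in_L[OF n]]
  have cO: "collapse n j \<in> order_preserving_maps n" if "1 \<le> j" "j < n" for j
    using LO[OF collapse_in_L[OF n]] that by auto
  have "map_mult n ?u (collapse n 1) = collapse n (n - 1)"
  proof (rule opm_eqI)
    fix x assume "1 \<le> x" "x \<le> n"
    then show "map_mult n ?u (collapse n 1) x = collapse n (n - 1) x"
      using n by (auto simp: map_mult_apply collapse_def shift_up_def)
  qed (use n in \<open>auto intro!: map_mult_closed uO cO\<close>)
  then have last: "collapse n (n - 1) \<in> T" using closed[OF up c[of 1]] n by auto
  have coll: "collapse n j \<in> T" if "1 \<le> j" "j < n" for j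
    using that last c[of j] by (cases "j = n - 1") auto
  have "map_mult n (map_mult n (collapse n (n - 2)) ?u) (collapse n (n - 1)) = skip n 1"
  proof (rule opm_eqI)
    fix x assume "1 \<le> x" "x \<le> n"
    then show "map_mult n (map_mult n (collapse n (n - 2)) ?u) (collapse n (n - 1)) x = skip n 1 x"
      using n by (auto simp: map_mult_apply collapse_def shift_up_def skip_def)
  qed (use n in \<open>auto intro!: map_mult_closed uO cO LO[OF skip_in_L]\<close>)
  then have "skip n 1 \<in> T" using closed[OF closed[OF c[of "n - 2"] up] last] n by auto
  then have skip: "skip n m \<in> T" if "1 \<le> m" "m \<le> n - 2" for m
    using that s[of m] by (cases "m = 1") auto
  note below = generate_maps_below_n[OF n closed coll skip]
  fix \<alpha> assume \<alpha>: "\<alpha> \<in> L_semigroup n 2"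
  note O = LO[OF \<alpha>]
  show "\<alpha> \<in> T"
  proof (cases "\<alpha> n < n")
    case True
    then show ?thesis using below O by simp
  next
    case False
    then have "\<alpha> 1 \<noteq> 1" using \<alpha> n opm_range[OF O, of n] by (auto simp: L_semigroup_2_iff)
    then have ge2: "2 \<le> \<alpha> y" if "1 \<le> y" "y \<le> n" for y
      using opm_mono[OF O, of 1 y] opm_range[OF O, of 1] that by auto
    define \<beta> where "\<beta> = (\<lambda>y\<in>{1..n}. \<alpha> y - 1)"
    have \<beta>O: "\<beta> \<in> order_preserving_maps n"
      unfolding \<beta>_def
    proof (intro restrict_opm)
      fix y assume y: "1 \<le> y" "y \<le> n"
      then show "1 \<le> \<alpha> y - 1 \<and> \<alpha> y - 1 \<le> n" using ge2[OF y] opm_range[OF O y] by auto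
    next
      fix y z assume "1 \<le> y" "y \<le> z" "z \<le> n"
      then show "\<alpha> y - 1 \<le> \<alpha> z - 1" using opm_mono[OF O, of y z] by auto
    qed
    have "\<beta> n < n" using opm_range[OF O, of n] n by (auto simp: \<beta>_def)
    then have "\<beta> \<in> T" using below \<beta>O by simp
    moreover have "map_mult n \<beta> ?u = \<alpha>"
    proof (rule opm_eqI[OF map_mult_closed[OF \<beta>O uO] O])
      fix y assume y: "1 \<le> y" "y \<le> n"
      show "map_mult n \<beta> ?u y = \<alpha> y"
        using y ge2[OF y] opm_range[OF O y]
        by (auto simp: map_mult_apply \<beta>_def shift_up_def)
    qed
    ultimately show ?thesis using closed[OF _ up] by metis
  qed
qed

section \<open>The rank\<close>

theorem theorem8:
  fixes n :: nat
  assumes "n \<ge> 3"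
  shows "semigroup_rank (map_mult n) (L_semigroup n 2) = 2 * n - 4"
proof -
  let ?S = "L_semigroup n 2" and ?A = "small_generators n"
  have n: "3 \<le> n" using assms .
  have sub: "?A \<subseteq> ?S"
    using shift_up_in_L[OF n] collapse_in_L[OF n] skip_in_L[OF n] n
    by (auto simp: small_generators_def)
  have A: "?A \<noteq> {}" "finite ?A" by (auto simp: small_generators_def)
  have "subsemigroup (map_mult n) ?S ?S"
    using L_semigroup_subsemigroup[of n 2] n by (auto simp: subsemigroup_def)
  then have "generated (map_mult n) ?S ?A \<subseteq> ?S" using sub unfolding generated_def by blast
  moreover have "?S \<subseteq> generated (map_mult n) ?S ?A"
    unfolding generated_def
  proof (rule Inter_greatest)
    fix T assume "T \<in> {T. subsemigroup (map_mult n) ?S T \<and> ?A \<subseteq> T}"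
    then show "?S \<subseteq> T"
      by (intro small_generators_generate[OF n]) (auto simp: subsemigroup_def)
  qed
  ultimately have gen: "?S = generated (map_mult n) ?S ?A" by blast
  have "card ?A = 2 * n - 4"
    using card_small_generators_le[OF n] generating_set_card_ge[OF n sub A gen] by simp
  then show ?thesis
    unfolding semigroup_rank_def
    using sub A gen generating_set_card_ge[OF n] by (intro Least_equality) blast+
qed

end
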